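(* Let $A\subset\mathbb R$ be a countable dense subset of $\mathbb R$ and let $B\subset\mathbb C$ be a countable dense subset of $\mathbb C$. The set of transcendental entire functions $f$ such that $f|_A\colon A\to B$ is a bijection, $f^{-1}(B)\cap\mathbb R=A$, and $f'(a)\neq 0$ for every $a\in A$, has the cardinality of the continuum.
   Context: A transcendental entire function is an entire function $f\colon\mathbb C\to\mathbb C$ that is not a polynomial. *)

theory Defs
  imports "HOL-Complex_Analysis.Complex_Analysis" "HOL-Library.Equipollence"
begin

definition transcendental_entire :: "(complex \<Rightarrow> complex) \<Rightarrow> bool" where
  "transcendental_entire f \<longleftrightarrow> f holomorphic_on UNIV \<and> \<not> (\<exists>p. f = poly p)"

end

theory Submission imports Defs begin

text \<open>A back-and-forth argument with polynomials. A finite injective assignment of points of \<open>A\<close>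
  to points of \<open>B\<close> is interpolated by a polynomial \<open>p\<close> with nonzero derivative at the nodes, and
  further nodes are added by small changes of the form \<open>k h\<close>, where \<open>h\<close> vanishes exactly at the
  old nodes. Since a smooth curve is a null set in the plane, a generic multiple of \<open>h\<close> moves the
  curve \<open>p(\<real>)\<close> off all points of the countable set \<open>B\<close> that are not values at nodes, so a value
  \<open>b\<close> that is still missing can be prescribed at a far away point of \<open>A\<close> without spoiling
  anything. The limit is entire with the required properties, and it is not a polynomial since its
  real trace contains a dense set. As the value at a new point can be chosen in two ways at each
  step, there are continuum many limits; there are no more since an entire function is determined
  by its values on a countable dense set.\<close>

section \<open>Polynomials vanishing exactly at a finite set of real nodes\<close>

definition node_poly :: "real set \<Rightarrow> complex poly" where
  "node_poly D = (\<Prod>d\<in>D. [:- complex_of_real d, 1:])"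

lemma node_poly_empty [simp]: "node_poly {} = 1"
  by (simp add: node_poly_def)

lemma poly_node_poly_insert:
  assumes "finite D" "a \<notin> D"
  shows "poly (node_poly (insert a D)) z = (z - complex_of_real a) * poly (node_poly D) z"
  using assms by (simp add: node_poly_def left_diff_distrib)

lemma poly_node_poly_eq_0_iff:
  assumes "finite D"
  shows "poly (node_poly D) (complex_of_real x) = 0 \<longleftrightarrow> x \<in> D"
  using assms by (auto simp: node_poly_def poly_prod)

text \<open>All zeros are simple: at \<open>d\<close> the product rule leaves only the product over
  the other nodes.\<close>

lemma poly_pderiv_node_poly_nonzero:
  assumes "finite D" "d \<in> D"
  shows "poly (pderiv (node_poly D)) (complex_of_real d) \<noteq> 0"
proof -
  have "node_poly D = [:- complex_of_real d, 1:] * node_poly (D - {d})"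
    unfolding node_poly_def using assms by (simp add: prod.remove)
  then have "poly (pderiv (node_poly D)) (complex_of_real d)
      = poly (node_poly (D - {d})) (complex_of_real d)"
    by (simp del: mult_pCons_left add: pderiv_mult pderiv_pCons)
  then show ?thesis
    using assms by (simp add: poly_node_poly_eq_0_iff)
qed

text \<open>On a disc every linear factor is bounded, so splitting off the factor belonging to
  \<open>d\<close> leaves a bounded product. The bound relative to the distance from
  \<open>d\<close> is the one that later controls difference quotients at the nodes.\<close>

lemma node_poly_bound:
  assumes "finite D"
  obtains M where "M > 0"
    and "\<And>z. norm z \<le> r \<Longrightarrow> norm (poly (node_poly D) z) \<le> M"
    and "\<And>z d. norm z \<le> r \<Longrightarrow> d \<in> D \<Longrightarrow>
           norm (poly (node_poly D) z) \<le> M * norm (z - complex_of_real d)"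
proof -
  have "\<exists>M>0. \<forall>z. norm z \<le> r \<longrightarrow> norm (poly (node_poly D) z) \<le> M \<and>
      (\<forall>d\<in>D. norm (poly (node_poly D) z) \<le> M * norm (z - complex_of_real d))"
    using assms
  proof (induction D rule: finite_induct)
    case empty
    show ?case by (intro exI[of _ 1]) auto
  next
    case (insert a D)
    then obtain M where M: "M > 0"
      "\<And>z. norm z \<le> r \<Longrightarrow> norm (poly (node_poly D) z) \<le> M"
      "\<And>z d. norm z \<le> r \<Longrightarrow> d \<in> D \<Longrightarrow>
         norm (poly (node_poly D) z) \<le> M * norm (z - complex_of_real d)"
      by blast
    \<comment> \<open>\<open>L\<close> bounds the new factor on the disc. The summand
      \<open>1\<close> gives \<open>L \<ge> 1\<close>, so \<open>L * M\<close> also dominates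
      \<open>M\<close> in the case \<open>d = a\<close>, where the new factor is itself the
      distance.\<close>
    define L where "L = \<bar>r\<bar> + \<bar>a\<bar> + 1"
    have L: "L \<ge> 1" "\<And>z. norm z \<le> r \<Longrightarrow> norm (z - complex_of_real a) \<le> L"
      using norm_triangle_ineq4[of _ "complex_of_real a"]
      by (auto simp: L_def) (smt (verit) norm_of_real)
    show ?case
    proof (intro exI[of _ "L * M"] conjI allI impI ballI)
      show "L * M > 0" using L(1) M(1) by simp
    next
      fix z :: complex assume z: "norm z \<le> r"
      show "norm (poly (node_poly (insert a D)) z) \<le> L * M"
        using insert.hyps L(1) L(2)[OF z] M(1) M(2)[OF z]
        by (simp add: poly_node_poly_insert norm_mult mult_mono)
      fix d assume "d \<in> insert a D"
      then consider "d = a" | "d \<in> D" by blast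
      then show "norm (poly (node_poly (insert a D)) z) \<le> L * M * norm (z - complex_of_real d)"
      proof cases
        case 1
        have "norm (poly (node_poly D) z) \<le> L * M"
          using M(2)[OF z] mult_right_mono[OF L(1), of M] M(1) by linarith
        then show ?thesis
          using 1 insert.hyps mult_left_mono[of "norm (poly (node_poly D) z)" "L * M" "norm (z - complex_of_real a)"]
          by (simp add: poly_node_poly_insert norm_mult mult.commute)
      next
        case 2
        have "norm (z - complex_of_real a) * norm (poly (node_poly D) z)
            \<le> L * (M * norm (z - complex_of_real d))"
          using L M(1) M(3)[OF z 2] z by (intro mult_mono) auto
        then show ?thesis
          using insert.hyps by (simp add: poly_node_poly_insert norm_mult mult.assoc)
      qed
    qed
  qed
  then show ?thesis using that by blast
qed

section \<open>Real traces of polynomials as null sets in the plane\<close>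

lemma poly_of_real_differentiable:
  "(\<lambda>x. poly p (complex_of_real x)) differentiable (at x within S)"
proof -
  have "((\<lambda>x. poly p (complex_of_real x)) has_vector_derivative
      1 * poly (pderiv p) (complex_of_real x)) (at x within S)"
    using field_vector_diff_chain_within[of complex_of_real 1 x S "poly p"]
    by (force simp: o_def intro: poly_DERIV has_field_derivative_at_within
          has_vector_derivative_of_real derivative_eq_intros)
  then show ?thesis by (rule differentiableI_vector)
qed

text \<open>A curve in the plane has measure zero, so almost every \<open>\<mu>\<close> avoids the values
  \<open>(b - p x) / h x\<close> for which \<open>p + \<mu> h\<close> hits \<open>b\<close> at \<open>x\<close>.\<close>

lemma generic_perturbation:
  fixes B :: "complex set" and p :: "complex poly"
  assumes "finite D" "countable B" "\<epsilon> > 0"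
  obtains \<mu> where "norm \<mu> < \<epsilon>"
    and "\<And>x. x \<notin> D \<Longrightarrow> poly (p + smult \<mu> (node_poly D)) (complex_of_real x) \<notin> B"
    and "\<And>d. d \<in> D \<Longrightarrow> poly (pderiv (p + smult \<mu> (node_poly D))) (complex_of_real d) \<noteq> 0"
proof -
  let ?h = "node_poly D"
  define hits where "hits = (\<Union>b\<in>B. (\<lambda>x. (b - poly p (complex_of_real x)) / poly ?h (complex_of_real x)) ` (- D))"
  \<comment> \<open>At a node the derivative of \<open>p + \<mu> h\<close> is affine in
    \<open>\<mu>\<close> with nonzero slope, so only one value of \<open>\<mu>\<close> per node has
    to be excluded.\<close>
  define crit where "crit = (\<lambda>d. - poly (pderiv p) (complex_of_real d) / poly (pderiv ?h) (complex_of_real d)) ` D"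
  have "negligible hits"
    unfolding hits_def
  proof (rule negligible_countable_Union)
    show "countable ((\<lambda>b. (\<lambda>x. (b - poly p (complex_of_real x)) / poly ?h (complex_of_real x)) ` (- D)) ` B)"
      using assms by simp
    fix S assume "S \<in> (\<lambda>b. (\<lambda>x. (b - poly p (complex_of_real x)) / poly ?h (complex_of_real x)) ` (- D)) ` B"
    then obtain b where S: "S = (\<lambda>x. (b - poly p (complex_of_real x)) / poly ?h (complex_of_real x)) ` (- D)"
      by blast
    show "negligible S"
      unfolding S
      by (rule negligible_differentiable_image_lowdim)
        (use assms in \<open>auto simp: differentiable_on_def poly_node_poly_eq_0_iff
           intro!: differentiable_divide differentiable_diff poly_of_real_differentiable\<close>)
  qed
  moreover have "negligible crit"
    unfolding crit_def using assms by (intro negligible_finite) simp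
  ultimately have "negligible (hits \<union> crit)" by simp
  moreover have "\<not> negligible (ball (0::complex) \<epsilon>)"
    using assms by (intro open_not_negligible) auto
  ultimately obtain \<mu> where \<mu>: "\<mu> \<in> ball 0 \<epsilon>" "\<mu> \<notin> hits" "\<mu> \<notin> crit"
    by (metis Un_iff negligible_subset subsetI)
  show ?thesis
  proof
    show "norm \<mu> < \<epsilon>" using \<mu> by simp
  next
    fix x assume x: "x \<notin> D"
    then have nz: "poly ?h (complex_of_real x) \<noteq> 0"
      using assms by (simp add: poly_node_poly_eq_0_iff)
    show "poly (p + smult \<mu> ?h) (complex_of_real x) \<notin> B"
    proof
      assume "poly (p + smult \<mu> ?h) (complex_of_real x) \<in> B"
      moreover have "\<mu> = (poly (p + smult \<mu> ?h) (complex_of_real x) - poly p (complex_of_real x))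
          / poly ?h (complex_of_real x)"
        using nz by simp
      ultimately show False
        using \<mu>(2) x unfolding hits_def by blast
    qed
  next
    fix d assume d: "d \<in> D"
    then have nz: "poly (pderiv ?h) (complex_of_real d) \<noteq> 0"
      using assms poly_pderiv_node_poly_nonzero by blast
    show "poly (pderiv (p + smult \<mu> ?h)) (complex_of_real d) \<noteq> 0"
    proof
      assume "poly (pderiv (p + smult \<mu> ?h)) (complex_of_real d) = 0"
      then have "\<mu> = - poly (pderiv p) (complex_of_real d) / poly (pderiv ?h) (complex_of_real d)"
        using nz by (simp add: pderiv_add pderiv_smult field_simps add_eq_0_iff)
      then show False
        using \<mu>(3) d unfolding crit_def by blast
    qed
  qed
qed

text \<open>A polynomial is proper, so its trace on the real line meets the unit disc in a
  compact curve, which cannot be dense there.\<close>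

lemma poly_image_reals_not_dense:
  fixes p :: "complex poly" and B :: "complex set"
  assumes "closure B = UNIV"
  shows "\<not> B \<subseteq> poly p ` \<real>"
proof
  assume B: "B \<subseteq> poly p ` \<real>"
  let ?g = "\<lambda>x. poly p (complex_of_real x)"
  have "\<exists>R. \<forall>x. R < \<bar>x\<bar> \<longrightarrow> degree p > 0 \<longrightarrow> norm (?g x) \<ge> 1"
  proof (cases "degree p > 0")
    case True
    have "\<forall>\<^sub>F z in at_infinity. 1 \<le> norm (poly p z)"
      using filterlim_poly_at_infinity[OF True] by (simp add: filterlim_at_infinity[of 0])
    then show ?thesis
      unfolding eventually_at_infinity by (metis less_imp_le norm_of_real real_norm_def)
  qed auto
  then obtain R where R: "\<And>x. R < \<bar>x\<bar> \<Longrightarrow> degree p > 0 \<Longrightarrow> norm (?g x) \<ge> 1"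
    by blast
  \<comment> \<open>The value \<open>?g 0\<close> is listed to cover constant \<open>p\<close>, for
    which \<open>R\<close> gives no information.\<close>
  define K where "K = insert (?g 0) (?g ` {-\<bar>R\<bar>..\<bar>R\<bar>})"
  have "continuous_on {-\<bar>R\<bar>..\<bar>R\<bar>} ?g"
    by (intro continuous_intros)
  then have "compact K"
    unfolding K_def by (intro compact_insert compact_continuous_image) auto
  then have "closed K" by (rule compact_imp_closed)
  have BK: "B \<inter> ball 0 1 \<subseteq> K"
  proof
    fix b assume b: "b \<in> B \<inter> ball 0 1"
    then obtain x where x: "b = ?g x" using B by (auto simp: Reals_def)
    show "b \<in> K"
    proof (cases "degree p > 0")
      case True
      then have "x \<in> {-\<bar>R\<bar>..\<bar>R\<bar>}" using R[of x] b x by fastforce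
      then show ?thesis unfolding K_def x by blast
    next
      case False
      then obtain c where "p = [:c:]" using degree_0_id[of p] by (metis neq0_conv)
      then show ?thesis unfolding K_def x by simp
    qed
  qed
  have "ball 0 1 \<subseteq> closure (B \<inter> ball 0 1)"
    using assms open_Int_closure_subset[of "ball 0 1" B] by (simp add: Int_commute)
  also have "\<dots> \<subseteq> K"
    using BK \<open>closed K\<close> by (rule closure_minimal)
  finally have "ball 0 1 \<subseteq> K" .
  moreover have "negligible K"
    unfolding K_def
  proof (subst negligible_insert, rule negligible_differentiable_image_lowdim)
    show "?g differentiable_on {-\<bar>R\<bar>..\<bar>R\<bar>}"
      unfolding differentiable_on_def by (blast intro: poly_of_real_differentiable)
  qed simp
  ultimately have "negligible (ball (0::complex) 1)"
    by (rule negligible_subset[rotated])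
  then show False
    using open_not_negligible[of "ball (0::complex) 1"] by simp
qed

section \<open>Closeness relative to the nodes, and limits of rapidly converging sequences\<close>

text \<open>The first bound yields locally uniform convergence. The second forces equality at every
  node in the disc and limits the change of difference quotients there, which preserves nonzero
  derivatives and the separation of values.\<close>

definition near :: "real \<Rightarrow> real \<Rightarrow> real set \<Rightarrow> (complex \<Rightarrow> complex) \<Rightarrow> (complex \<Rightarrow> complex) \<Rightarrow> bool" where
  "near r \<epsilon> D f g \<longleftrightarrow> (\<forall>z. norm z \<le> r \<longrightarrow> norm (g z - f z) \<le> \<epsilon> \<and>
     (\<forall>d\<in>D. norm (g z - f z) \<le> \<epsilon> * norm (z - complex_of_real d)))"

lemma near_trans:
  assumes "near r \<epsilon> D f g" "near r' \<delta> E g h" "r \<le> r'" "D \<subseteq> E"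
  shows "near r (\<epsilon> + \<delta>) D f h"
  unfolding near_def
proof (intro allI impI conjI ballI)
  fix z :: complex assume z: "norm z \<le> r"
  have tri: "norm (h z - f z) \<le> norm (g z - f z) + norm (h z - g z)"
    using norm_triangle_ineq[of "g z - f z" "h z - g z"] by simp
  have "norm (g z - f z) \<le> \<epsilon>" "norm (h z - g z) \<le> \<delta>"
    using assms z unfolding near_def by auto
  then show "norm (h z - f z) \<le> \<epsilon> + \<delta>"
    using tri by simp
  fix d assume d: "d \<in> D"
  have "norm (g z - f z) \<le> \<epsilon> * norm (z - complex_of_real d)"
    using assms z d unfolding near_def by blast
  moreover have "norm (h z - g z) \<le> \<delta> * norm (z - complex_of_real d)"
    using assms z d unfolding near_def by (meson order_trans subsetD)
  ultimately show "norm (h z - f z) \<le> (\<epsilon> + \<delta>) * norm (z - complex_of_real d)"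
    using tri by (simp add: distrib_right)
qed

lemma near_mono:
  assumes "near r \<epsilon> D f g" "\<epsilon> \<le> \<delta>"
  shows "near r \<delta> D f g"
  unfolding near_def
proof (intro allI impI conjI ballI)
  fix z :: complex assume z: "norm z \<le> r"
  show "norm (g z - f z) \<le> \<delta>" using assms z unfolding near_def by fastforce
  fix d assume d: "d \<in> D"
  have "norm (g z - f z) \<le> \<epsilon> * norm (z - complex_of_real d)"
    using assms z d unfolding near_def by blast
  also have "\<dots> \<le> \<delta> * norm (z - complex_of_real d)"
    using assms by (intro mult_right_mono) auto
  finally show "norm (g z - f z) \<le> \<delta> * norm (z - complex_of_real d)" .
qed

text \<open>By \<open>node_poly_bound\<close> the multiplier \<open>k\<close> only has to be small
  on the disc. Nothing is asked of it outside, which leaves room for large corrections at distant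
  points.\<close>

lemma near_node_poly_multiple:
  fixes p :: "complex poly"
  assumes "finite D" "\<epsilon> > 0"
  obtains \<eta> where "\<eta> > 0"
    and "\<And>k :: complex poly. (\<And>z. norm z \<le> r \<Longrightarrow> norm (poly k z) \<le> \<eta>) \<Longrightarrow>
           near r \<epsilon> D (poly p) (poly (p + k * node_poly D))"
proof -
  obtain M where M: "M > 0"
    "\<And>z. norm z \<le> r \<Longrightarrow> norm (poly (node_poly D) z) \<le> M"
    "\<And>z d. norm z \<le> r \<Longrightarrow> d \<in> D \<Longrightarrow>
       norm (poly (node_poly D) z) \<le> M * norm (z - complex_of_real d)"
    using node_poly_bound[OF assms(1)] by metis
  show ?thesis
  proof (rule that[of "\<epsilon> / M"])
    show "\<epsilon> / M > 0" using assms M by simp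
    fix k :: "complex poly" assume k: "\<And>z. norm z \<le> r \<Longrightarrow> norm (poly k z) \<le> \<epsilon> / M"
    show "near r \<epsilon> D (poly p) (poly (p + k * node_poly D))"
      unfolding near_def
    proof (intro allI impI conjI ballI)
      fix z :: complex assume z: "norm z \<le> r"
      have eq: "norm (poly (p + k * node_poly D) z - poly p z)
          = norm (poly k z) * norm (poly (node_poly D) z)"
        by (simp add: norm_mult)
      have "norm (poly k z) * norm (poly (node_poly D) z) \<le> \<epsilon> / M * M"
        using k[OF z] M z assms by (intro mult_mono) auto
      then show "norm (poly (p + k * node_poly D) z - poly p z) \<le> \<epsilon>"
        using eq M(1) by simp
      fix d assume d: "d \<in> D"
      have "norm (poly k z) * norm (poly (node_poly D) z) \<le> \<epsilon> / M * (M * norm (z - complex_of_real d))"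
        using k[OF z] M(1) M(3)[OF z d] assms by (intro mult_mono) auto
      then show "norm (poly (p + k * node_poly D) z - poly p z) \<le> \<epsilon> * norm (z - complex_of_real d)"
        using eq M(1) by simp
    qed
  qed
qed

text \<open>The discs exhaust the plane and \<open>c\<close> decays geometrically, so convergence is
  locally uniform and the limit is entire. All changes from stage \<open>n\<close> on add up to at
  most \<open>c n\<close>.\<close>

lemma near_sequence_limit:
  fixes f :: "nat \<Rightarrow> complex \<Rightarrow> complex" and c :: "nat \<Rightarrow> real" and D :: "nat \<Rightarrow> real set"
  assumes hol: "\<And>n. f n holomorphic_on UNIV"
    and c_pos: "\<And>n. c n > 0" and c_half: "\<And>n. c (Suc n) \<le> c n / 2"
    and D_mono: "\<And>n. D n \<subseteq> D (Suc n)"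
    and near: "\<And>n. near (real n) (c n / 2) (D n) (f n) (f (Suc n))"
  obtains g where "g holomorphic_on UNIV"
    and "\<And>z. (\<lambda>n. f n z) \<longlonglongrightarrow> g z"
    and "\<And>n. near (real n) (c n) (D n) (f n) g"
proof -
  have D_le: "D n \<subseteq> D (n + j)" for n j
    using lift_Suc_mono_le[of D, OF D_mono] by simp
  \<comment> \<open>A single change costs at most \<open>c m / 2 \<le> c m - c (Suc m)\<close>, so
    the costs telescope.\<close>
  have tele: "near (real n) (c n - c (n + j)) (D n) (f n) (f (n + j))" for n j
  proof (induction j)
    case 0
    show ?case by (simp add: near_def)
  next
    case (Suc j)
    have "near (real n) (c n - c (n + j) + c (n + j) / 2) (D n) (f n) (f (Suc (n + j)))"
      by (rule near_trans[OF Suc near _ D_le]) simp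
    moreover have "c n - c (n + j) + c (n + j) / 2 \<le> c n - c (n + Suc j)"
      using c_half[of "n + j"] by simp
    ultimately show ?case by (simp add: near_mono)
  qed
  have c_lim: "c \<longlonglongrightarrow> 0"
  proof (rule tendsto_sandwich[where f = "\<lambda>_. 0" and h = "\<lambda>n. c 0 * (1/2) ^ n"])
    have "c n \<le> c 0 * (1/2) ^ n" for n
    proof (induction n)
      case (Suc n)
      then show ?case using c_half[of n] by simp
    qed simp
    then show "\<forall>\<^sub>F n in sequentially. c n \<le> c 0 * (1/2) ^ n" by simp
    show "(\<lambda>n. c 0 * (1/2) ^ n) \<longlonglongrightarrow> 0"
      by (intro tendsto_mult_right_zero LIMSEQ_power_zero) simp
    show "\<forall>\<^sub>F n in sequentially. 0 \<le> c n"
      using c_pos by (simp add: less_imp_le)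
  qed simp
  have conv: "convergent (\<lambda>n. f n z)" for z
  proof (rule Cauchy_convergent, rule CauchyI')
    fix e :: real assume "e > 0"
    then have "\<forall>\<^sub>F n in sequentially. c n < e \<and> norm z \<le> real n"
      using order_tendstoD(2)[OF c_lim] eventually_ge_at_top[of "nat \<lceil>norm z\<rceil>"]
      by (auto elim!: eventually_elim2 simp: nat_le_iff ceiling_le_iff)
    then obtain N where N: "\<And>n. n \<ge> N \<Longrightarrow> c n < e \<and> norm z \<le> real n"
      by (auto simp: eventually_sequentially)
    show "\<exists>M. \<forall>m\<ge>M. \<forall>n>m. dist (f m z) (f n z) < e"
    proof (intro exI[of _ N] allI impI)
      fix m n assume "N \<le> m" "m < n"
      then obtain j where j: "n = m + j" using less_imp_add_positive by blast
      have "norm (f n z - f m z) \<le> c m - c n"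
        using tele[of m j] N[OF \<open>N \<le> m\<close>] unfolding near_def j by blast
      then show "dist (f m z) (f n z) < e"
        using N[OF \<open>N \<le> m\<close>] c_pos[of n] by (simp add: dist_norm norm_minus_commute)
    qed
  qed
  define g where "g = (\<lambda>z. lim (\<lambda>n. f n z))"
  have lim: "(\<lambda>n. f n z) \<longlonglongrightarrow> g z" for z
    using conv[of z] unfolding g_def by (simp add: convergent_LIMSEQ_iff)
  have near_g: "near (real n) (c n) (D n) (f n) g" for n
    unfolding near_def
  proof (intro allI impI conjI ballI)
    fix z :: complex assume z: "norm z \<le> real n"
    \<comment> \<open>Both bounds are non-strict and hold for all \<open>f (n + j)\<close>, so they
      survive the limit in \<open>j\<close>.\<close>
    have t: "(\<lambda>j. norm (f (n + j) z - f n z)) \<longlonglongrightarrow> norm (g z - f n z)"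
      using LIMSEQ_ignore_initial_segment[OF lim[of z], of n]
      by (intro tendsto_intros) (simp add: add.commute)
    have near': "near (real n) (c n) (D n) (f n) (f (n + j))" for j
      using near_mono[OF tele[of n j], of "c n"] c_pos[of "n + j"] by simp
    show "norm (g z - f n z) \<le> c n"
      by (rule LIMSEQ_le_const2[OF t]) (use near' z in \<open>auto simp: near_def\<close>)
    fix d assume "d \<in> D n"
    then show "norm (g z - f n z) \<le> c n * norm (z - complex_of_real d)"
      by (intro LIMSEQ_le_const2[OF t]) (use near' z in \<open>auto simp: near_def\<close>)
  qed
  have "g holomorphic_on UNIV"
  proof (rule holomorphic_uniform_sequence[OF open_UNIV hol])
    fix x :: complex
    have "uniform_limit (cball x 1) f g sequentially"
    proof (rule uniform_limitI)
      fix e :: real assume "e > 0"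
      then have "\<forall>\<^sub>F n in sequentially. c n < e"
        using order_tendstoD(2)[OF c_lim] by blast
      moreover have "\<forall>\<^sub>F n in sequentially. norm x + 1 \<le> real n"
        using eventually_ge_at_top[of "nat \<lceil>norm x + 1\<rceil>"]
        by (rule eventually_mono) linarith
      ultimately show "\<forall>\<^sub>F n in sequentially. \<forall>y\<in>cball x 1. dist (f n y) (g y) < e"
      proof eventually_elim
        case (elim n)
        show ?case
        proof
          fix y assume "y \<in> cball x 1"
          then have "norm y \<le> real n"
            using elim(2) norm_triangle_sub[of y x] by (simp add: dist_norm norm_minus_commute[of y x])
          then have "norm (g y - f n y) \<le> c n"
            using near_g[of n] by (simp add: near_def)
          then show "dist (f n y) (g y) < e"
            using elim(1) by (simp add: dist_norm norm_minus_commute[of "f n y"])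
        qed
      qed
    qed
    then show "\<exists>d>0. cball x d \<subseteq> UNIV \<and> uniform_limit (cball x d) f g sequentially"
      by (intro exI[of _ 1]) simp
  qed
  then show ?thesis using lim near_g by (rule that)
qed

section \<open>Interpolating polynomials and the insertion of new nodes\<close>

locale countable_dense_pair =
  fixes A :: "real set" and B :: "complex set"
  assumes countable_A: "countable A" and dense_A: "closure A = UNIV"
    and countable_B: "countable B" and dense_B: "closure B = UNIV"
begin

text \<open>Injectivity on \<open>D\<close> and avoidance of \<open>B\<close> off \<open>D\<close>
  together separate the value at a node from the values at all other real points. With the
  derivative condition, the difference quotient at a node has no real zero.\<close>

definition interpolant :: "complex poly \<Rightarrow> real set \<Rightarrow> bool" where
  "interpolant p D \<longleftrightarrow> finite D \<and> D \<subseteq> A \<and>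
     inj_on (\<lambda>x. poly p (complex_of_real x)) D \<and>
     (\<forall>d\<in>D. poly p (complex_of_real d) \<in> B) \<and>
     (\<forall>x. x \<notin> D \<longrightarrow> poly p (complex_of_real x) \<notin> B) \<and>
     (\<forall>d\<in>D. poly (pderiv p) (complex_of_real d) \<noteq> 0)"

text \<open>Agreement at the nodes is a clause of its own because \<open>near\<close> forces it only
  for nodes in the disc of radius \<open>r\<close>.\<close>

definition extends :: "real \<Rightarrow> real \<Rightarrow> complex poly \<Rightarrow> real set \<Rightarrow> complex poly \<Rightarrow> real set \<Rightarrow> bool" where
  "extends r \<epsilon> p D q E \<longleftrightarrow> interpolant q E \<and> D \<subseteq> E \<and>
     (\<forall>d\<in>D. poly q (complex_of_real d) = poly p (complex_of_real d)) \<and>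
     near r \<epsilon> D (poly p) (poly q)"

lemma extends_trans:
  assumes "extends r \<epsilon> p D q E" "extends r \<delta> q E s G"
  shows "extends r (\<epsilon> + \<delta>) p D s G"
  using assms near_trans[of r \<epsilon> D "poly p" "poly q" r \<delta> E "poly s"]
  unfolding extends_def by (auto dest: subsetD)

lemma extends_refl:
  assumes "interpolant p D" "\<epsilon> > 0"
  shows "extends r \<epsilon> p D p D"
  using assms by (auto simp: extends_def near_def)

text \<open>Adding a small constant multiple of \<open>node_poly D\<close> keeps the prescribed
  values, and a generic constant supplies the two remaining conditions: avoidance of
  \<open>B\<close> off \<open>D\<close> and nonzero derivatives on \<open>D\<close>.\<close>

lemma exists_interpolant_near:
  assumes "finite D" "D \<subseteq> A" "inj_on (\<lambda>x. poly p (complex_of_real x)) D"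
    and "\<And>d. d \<in> D \<Longrightarrow> poly p (complex_of_real d) \<in> B" and "\<epsilon> > 0"
  obtains q where "interpolant q D" "near r \<epsilon> D (poly p) (poly q)"
    and "\<And>d. d \<in> D \<Longrightarrow> poly q (complex_of_real d) = poly p (complex_of_real d)"
proof -
  obtain \<eta> where \<eta>: "\<eta> > 0"
    "\<And>k. (\<And>z. norm z \<le> r \<Longrightarrow> norm (poly k z) \<le> \<eta>) \<Longrightarrow>
       near r \<epsilon> D (poly p) (poly (p + k * node_poly D))"
    using near_node_poly_multiple[OF assms(1,5)] by metis
  obtain \<mu> where \<mu>: "norm \<mu> < \<eta>"
    "\<And>x. x \<notin> D \<Longrightarrow> poly (p + smult \<mu> (node_poly D)) (complex_of_real x) \<notin> B"
    "\<And>d. d \<in> D \<Longrightarrow> poly (pderiv (p + smult \<mu> (node_poly D))) (complex_of_real d) \<noteq> 0"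
    using generic_perturbation[OF assms(1) countable_B \<eta>(1)] by metis
  let ?q = "p + smult \<mu> (node_poly D)"
  have eq: "poly ?q (complex_of_real d) = poly p (complex_of_real d)" if "d \<in> D" for d
    using that assms(1) by (simp add: poly_node_poly_eq_0_iff)
  show ?thesis
  proof (rule that[of ?q])
    show "interpolant ?q D"
      unfolding interpolant_def
    proof (intro conjI)
      show "inj_on (\<lambda>x. poly ?q (complex_of_real x)) D"
        using assms(3) eq by (subst inj_on_cong[where g = "\<lambda>x. poly p (complex_of_real x)"]) auto
      show "\<forall>d\<in>D. poly ?q (complex_of_real d) \<in> B"
        using assms(4) eq by (simp del: poly_add)
    qed (use assms(1,2) \<mu> in auto)
    show "near r \<epsilon> D (poly p) (poly ?q)"
      using \<eta>(2)[of "[:\<mu>:]"] \<mu>(1) by simp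
  qed (rule eq)
qed

text \<open>The common end of both insertion steps. Half of the allowance pays for the correction
  \<open>k\<close> that puts the value \<open>b\<close> at \<open>a\<close>; the other half pays for
  the generic change that makes the result an interpolant on the enlarged node set.\<close>

lemma extends_insert:
  assumes p: "interpolant p D" and a: "a \<in> A" "a \<notin> D"
    and b: "b \<in> B" "b \<notin> (\<lambda>x. poly p (complex_of_real x)) ` D" and "\<epsilon> > 0"
    and near: "near r (\<epsilon> / 2) D (poly p) (poly (p + k * node_poly D))"
    and val: "poly (p + k * node_poly D) (complex_of_real a) = b"
  obtains q where "extends r \<epsilon> p D q (insert a D)" "poly q (complex_of_real a) = b"
proof -
  let ?p = "p + k * node_poly D"
  have "finite D" using p by (simp add: interpolant_def)
  have eq: "poly ?p (complex_of_real d) = poly p (complex_of_real d)" if "d \<in> D" for d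
    using that \<open>finite D\<close> by (simp add: poly_node_poly_eq_0_iff)
  have "inj_on (\<lambda>x. poly ?p (complex_of_real x)) D"
    using p eq by (subst inj_on_cong[where g = "\<lambda>x. poly p (complex_of_real x)"])
      (auto simp: interpolant_def)
  moreover have "(\<lambda>x. poly ?p (complex_of_real x)) ` D = (\<lambda>x. poly p (complex_of_real x)) ` D"
    using eq by (intro image_cong) auto
  ultimately have inj: "inj_on (\<lambda>x. poly ?p (complex_of_real x)) (insert a D)"
    unfolding inj_on_insert val using b(2) a(2) by simp
  have in_B: "poly ?p (complex_of_real d) \<in> B" if "d \<in> insert a D" for d
  proof (cases "d = a")
    case True
    then show ?thesis using b(1) val by metis
  next
    case False
    then have "d \<in> D" using that by blast
    then show ?thesis using p eq unfolding interpolant_def by metis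
  qed
  have D: "finite (insert a D)" "insert a D \<subseteq> A" "\<epsilon> / 2 > 0"
    using p a \<open>\<epsilon> > 0\<close> by (auto simp: interpolant_def)
  obtain q where q: "interpolant q (insert a D)"
    "near r (\<epsilon> / 2) (insert a D) (poly ?p) (poly q)"
    "\<And>d. d \<in> insert a D \<Longrightarrow> poly q (complex_of_real d) = poly ?p (complex_of_real d)"
    using exists_interpolant_near[OF D(1,2) inj in_B D(3)] by blast
  show ?thesis
  proof
    have "near r (\<epsilon> / 2 + \<epsilon> / 2) D (poly p) (poly q)"
      by (rule near_trans[OF near q(2)]) auto
    then have "near r \<epsilon> D (poly p) (poly q)" by simp
    moreover have "\<forall>d\<in>D. poly q (complex_of_real d) = poly p (complex_of_real d)"
      using q(3) eq by (metis insertI2)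
    ultimately show "extends r \<epsilon> p D q (insert a D)"
      unfolding extends_def using q(1) by blast
    show "poly q (complex_of_real a) = b" using q(3) val by (metis insertI1)
  qed
qed

text \<open>The point is prescribed but its value is free, so density of \<open>B\<close> offers a
  value close to the current one and a small constant \<open>k\<close> suffices. Values in the
  finite set \<open>F\<close> can be avoided, which later provides a second, different
  choice.\<close>

lemma extends_insert_point:
  assumes p: "interpolant p D" and a: "a \<in> A" "a \<notin> D" and "finite F" "\<epsilon> > 0"
  obtains q where "extends r \<epsilon> p D q (insert a D)" "poly q (complex_of_real a) \<notin> F"
proof -
  have "finite D" using p by (simp add: interpolant_def)
  obtain \<eta> where \<eta>: "\<eta> > 0"
    "\<And>k. (\<And>z. norm z \<le> r \<Longrightarrow> norm (poly k z) \<le> \<eta>) \<Longrightarrow>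
       near r (\<epsilon> / 2) D (poly p) (poly (p + k * node_poly D))"
    using near_node_poly_multiple[OF \<open>finite D\<close>, of "\<epsilon> / 2"] \<open>\<epsilon> > 0\<close> by (metis half_gt_zero)
  let ?h = "poly (node_poly D) (complex_of_real a)"
  have h: "?h \<noteq> 0" using a \<open>finite D\<close> by (simp add: poly_node_poly_eq_0_iff)
  \<comment> \<open>Moving the value at \<open>a\<close> by less than this radius takes a constant
    \<open>k\<close> of norm below \<open>\<eta>\<close>.\<close>
  let ?U = "ball (poly p (complex_of_real a)) (\<eta> * norm ?h)"
  let ?F = "F \<union> (\<lambda>x. poly p (complex_of_real x)) ` D"
  have "open (?U - ?F)"
    using \<open>finite D\<close> \<open>finite F\<close> by (intro open_Diff finite_imp_closed) auto
  moreover have "?U - ?F \<noteq> {}"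
  proof
    assume "?U - ?F = {}"
    then have "?U \<subseteq> ?F" by blast
    then have "finite ?U" using \<open>finite D\<close> \<open>finite F\<close> by (meson finite_UnI finite_imageI finite_subset)
    moreover have "\<not> countable ?U" using h \<eta>(1) by (intro uncountable_ball) simp
    ultimately show False using countable_finite by blast
  qed
  ultimately have "B \<inter> (?U - ?F) \<noteq> {}"
    using dense_B open_Int_closure_eq_empty[of "?U - ?F" B] by auto
  then obtain b where b: "b \<in> B" "b \<in> ?U" "b \<notin> ?F" by blast
  let ?k = "[:(b - poly p (complex_of_real a)) / ?h:]"
  have "near r (\<epsilon> / 2) D (poly p) (poly (p + ?k * node_poly D))"
  proof (rule \<eta>(2))
    show "norm (poly ?k z) \<le> \<eta>" for z
      using b(2) h by (simp add: norm_divide dist_norm norm_minus_commute field_simps)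
  qed
  moreover have "poly (p + ?k * node_poly D) (complex_of_real a) = b"
    using h by simp
  ultimately obtain q where "extends r \<epsilon> p D q (insert a D)" "poly q (complex_of_real a) = b"
    using extends_insert[OF p a b(1) _ \<open>\<epsilon> > 0\<close>] b(3) by blast
  then show ?thesis using that b(3) by blast
qed

lemma exists_large_point:
  assumes "finite D"
  obtains a where "a \<in> A" "a \<notin> D" "r < \<bar>a\<bar>" "a \<noteq> 0"
proof -
  have "open ({\<bar>r\<bar><..} - D)"
    using assms by (intro open_Diff finite_imp_closed) auto
  moreover have "{\<bar>r\<bar><..} - D \<noteq> {}"
    using assms infinite_Ioi[of "\<bar>r\<bar>"] by (metis Diff_eq_empty_iff finite_subset)
  ultimately have "A \<inter> ({\<bar>r\<bar><..} - D) \<noteq> {}"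
    using dense_A open_Int_closure_eq_empty[of "{\<bar>r\<bar><..} - D" A] by auto
  then show ?thesis using that by fastforce
qed

text \<open>The new node lies outside the disc where the change has to be small, so a high power of
  \<open>z / a\<close> makes the correction as small as needed.\<close>

lemma extends_insert_value:
  assumes p: "interpolant p D" and b: "b \<in> B" "b \<notin> (\<lambda>x. poly p (complex_of_real x)) ` D"
    and "\<epsilon> > 0"
  obtains q a where "extends r \<epsilon> p D q (insert a D)" "poly q (complex_of_real a) = b"
proof -
  have "finite D" using p by (simp add: interpolant_def)
  obtain \<eta> where \<eta>: "\<eta> > 0"
    "\<And>k. (\<And>z. norm z \<le> r \<Longrightarrow> norm (poly k z) \<le> \<eta>) \<Longrightarrow>
       near r (\<epsilon> / 2) D (poly p) (poly (p + k * node_poly D))"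
    using near_node_poly_multiple[OF \<open>finite D\<close>, of "\<epsilon> / 2"] \<open>\<epsilon> > 0\<close> by (metis half_gt_zero)
  obtain a where a: "a \<in> A" "a \<notin> D" "\<bar>r\<bar> < \<bar>a\<bar>" "a \<noteq> 0"
    using exists_large_point[OF \<open>finite D\<close>] by metis
  let ?h = "poly (node_poly D) (complex_of_real a)"
  have h: "?h \<noteq> 0" using a \<open>finite D\<close> by (simp add: poly_node_poly_eq_0_iff)
  \<comment> \<open>The multiplier \<open>k\<close> must take the value \<open>C\<close> at
    \<open>a\<close>, however large \<open>C\<close> is; hence \<open>k z = C * (z / a) ^ K\<close>
    below.\<close>
  define C where "C = (b - poly p (complex_of_real a)) / ?h"
  have "(\<lambda>K. norm C * (\<bar>r\<bar> / \<bar>a\<bar>) ^ K) \<longlonglongrightarrow> 0"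
    using a by (intro tendsto_mult_right_zero LIMSEQ_power_zero) simp
  then obtain K where K: "norm C * (\<bar>r\<bar> / \<bar>a\<bar>) ^ K < \<eta>"
    using order_tendstoD(2)[OF _ \<eta>(1)] by (metis eventually_sequentially order_refl)
  define k where "k = monom (C / complex_of_real a ^ K) K"
  have "near r (\<epsilon> / 2) D (poly p) (poly (p + k * node_poly D))"
  proof (rule \<eta>(2))
    fix z :: complex assume z: "norm z \<le> r"
    have "norm (poly k z) = norm C * (norm z / \<bar>a\<bar>) ^ K"
      by (simp add: k_def poly_monom norm_mult norm_divide norm_power power_divide)
    also have "\<dots> \<le> norm C * (\<bar>r\<bar> / \<bar>a\<bar>) ^ K"
      using z by (intro mult_left_mono power_mono divide_right_mono) auto
    finally show "norm (poly k z) \<le> \<eta>" using K by simp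
  qed
  moreover have "poly (p + k * node_poly D) (complex_of_real a) = b"
    using h a by (simp add: k_def C_def poly_monom)
  ultimately obtain q where "extends r \<epsilon> p D q (insert a D)" "poly q (complex_of_real a) = b"
    using extends_insert[OF p a(1,2) b \<open>\<epsilon> > 0\<close>] by blast
  then show ?thesis using that by blast
qed

text \<open>One round of the back-and-forth: half of the allowance serves the point
  \<open>a\<close>, the other half the value \<open>b\<close>. Whichever is already present requires
  no change.\<close>

lemma extends_cover:
  assumes p: "interpolant p D" and a: "a \<in> A" and b: "b \<in> B" and "\<epsilon> > 0"
  obtains q E where "extends r \<epsilon> p D q E" "a \<in> E" "b \<in> (\<lambda>x. poly q (complex_of_real x)) ` E"
proof -
  have e: "\<epsilon> / 2 > 0" using \<open>\<epsilon> > 0\<close> by simp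
  obtain q E where q: "extends r (\<epsilon> / 2) p D q E" "a \<in> E"
  proof (cases "a \<in> D")
    case True
    then show ?thesis using that extends_refl[OF p e] by blast
  next
    case False
    then show ?thesis
      using that extends_insert_point[OF p a False finite.emptyI e] by (metis insertI1)
  qed
  then have q_int: "interpolant q E" by (simp add: extends_def)
  obtain s G where s: "extends r (\<epsilon> / 2) q E s G" "b \<in> (\<lambda>x. poly s (complex_of_real x)) ` G"
  proof (cases "b \<in> (\<lambda>x. poly q (complex_of_real x)) ` E")
    case True
    then show ?thesis using that extends_refl[OF q_int e] by blast
  next
    case False
    then show ?thesis
      using that extends_insert_value[OF q_int b False e] by (metis imageI insertI1)
  qed
  have "extends r \<epsilon> p D s G"
    using extends_trans[OF q(1) s(1)] by simp
  moreover have "a \<in> G" using q(2) s(1) by (auto simp: extends_def)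
  ultimately show ?thesis using that s(2) by blast
qed

text \<open>A fresh node \<open>x\<close> is inserted first, the second time with the first value
  forbidden. Since extensions keep the values at nodes, the difference at \<open>x\<close> persists
  through the two covering rounds.\<close>

lemma extends_cover_two_ways:
  assumes p: "interpolant p D" and a: "a \<in> A" and b: "b \<in> B" and "\<epsilon> > 0"
  obtains q E q' E' x
  where "extends r \<epsilon> p D q E" "a \<in> E" "b \<in> (\<lambda>x. poly q (complex_of_real x)) ` E"
    and "extends r \<epsilon> p D q' E'" "a \<in> E'" "b \<in> (\<lambda>x. poly q' (complex_of_real x)) ` E'"
    and "x \<in> E" "x \<in> E'" "poly q (complex_of_real x) \<noteq> poly q' (complex_of_real x)"
proof -
  have e: "\<epsilon> / 2 > 0" using \<open>\<epsilon> > 0\<close> by simp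
  obtain x where x: "x \<in> A" "x \<notin> D"
    using p exists_large_point by (metis interpolant_def)
  obtain s where s: "extends r (\<epsilon> / 2) p D s (insert x D)"
    using extends_insert_point[OF p x finite.emptyI e] by blast
  obtain s' where s': "extends r (\<epsilon> / 2) p D s' (insert x D)"
    "poly s' (complex_of_real x) \<notin> {poly s (complex_of_real x)}"
    using extends_insert_point[OF p x _ e] by (metis finite.emptyI finite_insert)
  obtain q E where q: "extends r (\<epsilon> / 2) s (insert x D) q E" "a \<in> E"
    "b \<in> (\<lambda>x. poly q (complex_of_real x)) ` E"
    using extends_cover[OF _ a b e] s by (metis extends_def)
  obtain q' E' where q': "extends r (\<epsilon> / 2) s' (insert x D) q' E'" "a \<in> E'"
    "b \<in> (\<lambda>x. poly q' (complex_of_real x)) ` E'"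
    using extends_cover[OF _ a b e] s' by (metis extends_def)
  have "poly q (complex_of_real x) \<noteq> poly q' (complex_of_real x)" "x \<in> E" "x \<in> E'"
    using q(1) q'(1) s'(2) by (auto simp: extends_def)
  moreover have "extends r \<epsilon> p D q E" "extends r \<epsilon> p D q' E'"
    using extends_trans[OF s q(1)] extends_trans[OF s'(1) q'(1)] by auto
  ultimately show ?thesis using that q q' by blast
qed

section \<open>Separation constants and the recursive step\<close>

text \<open>Dividing \<open>p - p(d)\<close> by its linear factor at \<open>d\<close> gives a
  quotient without real zeros, whose modulus has a positive minimum on a compact interval. Finitely
  many nodes allow a common constant.\<close>

lemma exists_separation:
  assumes p: "interpolant p D" and "u > 0"
  obtains c where "0 < c" "c \<le> u"
    and "\<And>d x. d \<in> D \<Longrightarrow> \<bar>x\<bar> \<le> r \<Longrightarrow>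
      2 * c * \<bar>x - d\<bar> \<le> norm (poly p (complex_of_real x) - poly p (complex_of_real d))"
proof -
  have "\<exists>c>0. \<forall>x. \<bar>x\<bar> \<le> r \<longrightarrow>
      c * \<bar>x - d\<bar> \<le> norm (poly p (complex_of_real x) - poly p (complex_of_real d))"
    if d: "d \<in> D" for d
  proof -
    have "poly (p - [:poly p (complex_of_real d):]) (complex_of_real d) = 0" by simp
    then obtain g where g: "p - [:poly p (complex_of_real d):] = [:- complex_of_real d, 1:] * g"
      unfolding poly_eq_0_iff_dvd by (elim dvdE)
    have eq: "poly p z - poly p (complex_of_real d) = (z - complex_of_real d) * poly g z" for z
      using arg_cong[OF g, of "\<lambda>q. poly q z"] by (simp add: left_diff_distrib)
    have "pderiv p = pderiv (p - [:poly p (complex_of_real d):])"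
      by (simp add: pderiv_diff pderiv_pCons)
    also have "\<dots> = [:- complex_of_real d, 1:] * pderiv g + g"
      unfolding g by (simp del: mult_pCons_left add: pderiv_mult pderiv_pCons)
    finally have "poly (pderiv p) (complex_of_real d) = poly g (complex_of_real d)"
      by simp
    then have "poly g (complex_of_real d) \<noteq> 0"
      using p d unfolding interpolant_def by metis
    moreover have "poly g (complex_of_real x) \<noteq> 0" if "x \<noteq> d" for x
    proof -
      \<comment> \<open>For \<open>x\<close> in \<open>D\<close> this is injectivity; otherwise the
        value at \<open>x\<close> lies outside \<open>B\<close> while the value at \<open>d\<close>
        lies in it.\<close>
      have "poly p (complex_of_real x) \<noteq> poly p (complex_of_real d)"
        using p d that unfolding interpolant_def inj_on_def by metis
      then show ?thesis using eq[of "complex_of_real x"] by auto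
    qed
    ultimately have nz: "poly g (complex_of_real x) \<noteq> 0" for x by (cases "x = d") auto
    \<comment> \<open>The absolute values keep the interval nonempty when \<open>r\<close> is
      negative.\<close>
    have "continuous_on {-\<bar>r\<bar>..\<bar>r\<bar>} (\<lambda>x. norm (poly g (complex_of_real x)))"
      by (intro continuous_intros)
    then obtain x0 where x0: "\<And>x. x \<in> {-\<bar>r\<bar>..\<bar>r\<bar>} \<Longrightarrow>
        norm (poly g (complex_of_real x0)) \<le> norm (poly g (complex_of_real x))"
      using continuous_attains_inf[of "{-\<bar>r\<bar>..\<bar>r\<bar>}"] by fastforce
    show ?thesis
    proof (intro exI[of _ "norm (poly g (complex_of_real x0))"] conjI allI impI)
      show "norm (poly g (complex_of_real x0)) > 0" using nz by simp
      fix x assume "\<bar>x\<bar> \<le> r"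
      then have "norm (poly g (complex_of_real x0)) \<le> norm (poly g (complex_of_real x))"
        by (intro x0) auto
      then show "norm (poly g (complex_of_real x0)) * \<bar>x - d\<bar>
          \<le> norm (poly p (complex_of_real x) - poly p (complex_of_real d))"
        unfolding eq norm_mult of_real_diff[symmetric] norm_of_real
        by (simp add: mult.commute mult_left_mono)
    qed
  qed
  then obtain c where c: "\<And>d. d \<in> D \<Longrightarrow> c d > 0"
    "\<And>d x. d \<in> D \<Longrightarrow> \<bar>x\<bar> \<le> r \<Longrightarrow>
      c d * \<bar>x - d\<bar> \<le> norm (poly p (complex_of_real x) - poly p (complex_of_real d))"
    by metis
  have fin: "finite (insert u (c ` D))" using p by (simp add: interpolant_def)
  \<comment> \<open>Including \<open>u\<close> gives the upper bound; the witness is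
    \<open>m / 2\<close> because of the factor \<open>2\<close> in the claim.\<close>
  define m where "m = Min (insert u (c ` D))"
  have m: "m > 0" "m \<le> u" "\<And>d. d \<in> D \<Longrightarrow> m \<le> c d"
    using fin c(1) \<open>u > 0\<close> unfolding m_def by (auto simp del: Min_insert)
  show ?thesis
  proof (rule that[of "m / 2"])
    fix d x assume d: "d \<in> D" and x: "\<bar>x\<bar> \<le> r"
    have "m * \<bar>x - d\<bar> \<le> c d * \<bar>x - d\<bar>"
      using m(3)[OF d] by (intro mult_right_mono) auto
    then show "2 * (m / 2) * \<bar>x - d\<bar>
        \<le> norm (poly p (complex_of_real x) - poly p (complex_of_real d))"
      using c(2)[OF d x] by simp
  qed (use m in auto)
qed

text \<open>The factor \<open>2\<close> is a reserve: later changes total at most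
  \<open>c * |x - d|\<close>, so a separation with constant \<open>c\<close> survives in the
  limit.\<close>

definition admissible :: "nat \<Rightarrow> complex poly \<times> real set \<times> real \<Rightarrow> bool" where
  "admissible n = (\<lambda>(p, D, c). interpolant p D \<and> 0 < c \<and>
     (\<forall>d\<in>D. \<forall>x. \<bar>x\<bar> \<le> real n \<longrightarrow>
        2 * c * \<bar>x - d\<bar> \<le> norm (poly p (complex_of_real x) - poly p (complex_of_real d))))"

text \<open>The third component of a state bounds the sum of all later changes, relative to the
  distance from the nodes: each change is at most half of it and it is halved at each step. So
  in the limit a node stays simple and its value is not attained anew on the current
  interval.\<close>

definition refines :: "nat \<Rightarrow> complex poly \<times> real set \<times> real \<Rightarrow> complex poly \<times> real set \<times> real \<Rightarrow> bool" where
  "refines n = (\<lambda>(p, D, c) (q, E, c'). admissible (Suc n) (q, E, c') \<and>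
     extends (real n) (c / 2) p D q E \<and> c' \<le> c / 2 \<and>
     from_nat_into A n \<in> E \<and> from_nat_into B n \<in> (\<lambda>x. poly q (complex_of_real x)) ` E)"

lemma A_nonempty: "A \<noteq> {}" and B_nonempty: "B \<noteq> {}"
  using dense_A dense_B by auto

text \<open>Without nodes there is nothing to separate, but the real trace must avoid
  \<open>B\<close> entirely; a generic perturbation of the zero polynomial achieves this.\<close>

lemma admissible_start: "\<exists>p. admissible 0 (p, {}, 1)"
proof -
  obtain p where "interpolant p {}"
    using exists_interpolant_near[of "{}" 0 1] by auto
  then show ?thesis by (auto simp: admissible_def)
qed

lemma refines_two_ways:
  assumes "admissible n S"
  shows "\<exists>T T'. refines n S T \<and> refines n S T' \<and>
    (\<exists>x \<in> fst (snd T) \<inter> fst (snd T').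
       poly (fst T) (complex_of_real x) \<noteq> poly (fst T') (complex_of_real x))"
proof -
  obtain p D c where S: "S = (p, D, c)" by (cases S)
  have p: "interpolant p D" and c: "c / 2 > 0"
    using assms by (auto simp: S admissible_def)
  have "from_nat_into A n \<in> A" "from_nat_into B n \<in> B"
    using A_nonempty B_nonempty by (auto intro: from_nat_into)
  then obtain q E q' E' x
    where q: "extends (real n) (c / 2) p D q E" "from_nat_into A n \<in> E"
        "from_nat_into B n \<in> (\<lambda>x. poly q (complex_of_real x)) ` E"
      and q': "extends (real n) (c / 2) p D q' E'" "from_nat_into A n \<in> E'"
        "from_nat_into B n \<in> (\<lambda>x. poly q' (complex_of_real x)) ` E'"
      and x: "x \<in> E" "x \<in> E'" "poly q (complex_of_real x) \<noteq> poly q' (complex_of_real x)"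
    using extends_cover_two_ways[OF p _ _ c] by metis
  \<comment> \<open>Either extension can be completed to a state. The new constant is taken on the
    interval of radius \<open>Suc n\<close>, as admissibility at the next stage demands.\<close>
  have "\<exists>e. refines n S (s, G, e)"
    if s: "extends (real n) (c / 2) p D s G" "from_nat_into A n \<in> G"
      "from_nat_into B n \<in> (\<lambda>x. poly s (complex_of_real x)) ` G" for s G
  proof -
    have "interpolant s G" using s(1) by (simp add: extends_def)
    then obtain e where "0 < e" "e \<le> c / 2"
      "\<And>d x. d \<in> G \<Longrightarrow> \<bar>x\<bar> \<le> real (Suc n) \<Longrightarrow>
        2 * e * \<bar>x - d\<bar> \<le> norm (poly s (complex_of_real x) - poly s (complex_of_real d))"
      using exists_separation[OF _ c] by metis
    then show ?thesis
      using s \<open>interpolant s G\<close> unfolding S refines_def admissible_def by auto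
  qed
  from this[OF q] this[OF q'] obtain e e' where "refines n S (q, E, e)" "refines n S (q', E', e')"
    by blast
  then show ?thesis
    using x by (intro exI[of _ "(q, E, e)"] exI[of _ "(q', E', e')"]) auto
qed

section \<open>Limits of the construction and the lower bound\<close>

definition exact_curves :: "(complex \<Rightarrow> complex) set" where
  "exact_curves = {f. transcendental_entire f
     \<and> bij_betw (\<lambda>a. f (complex_of_real a)) A B
     \<and> f -` B \<inter> \<real> = complex_of_real ` A
     \<and> (\<forall>a\<in>A. deriv f (complex_of_real a) \<noteq> 0)}"

text \<open>The enumerations of \<open>A\<close> and \<open>B\<close> are worked off one entry per
  stage, so every point of \<open>A\<close> becomes a node and every element of \<open>B\<close> a
  value at a node. The estimate \<open>f_sep\<close> then yields injectivity and nonzero derivatives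
  alike.\<close>

lemma limit_in_exact_curves:
  fixes S :: "nat \<Rightarrow> complex poly \<times> real set \<times> real"
  assumes start: "admissible 0 (S 0)" and step: "\<And>n. refines n (S n) (S (Suc n))"
  obtains f where "f \<in> exact_curves"
    and "\<And>n d. d \<in> fst (snd (S n)) \<Longrightarrow> f (complex_of_real d) = poly (fst (S n)) (complex_of_real d)"
proof -
  define P D c where "P = (\<lambda>n. fst (S n))" and "D = (\<lambda>n. fst (snd (S n)))"
    and "c = (\<lambda>n. snd (snd (S n)))"
  have S: "S n = (P n, D n, c n)" for n by (simp add: P_def D_def c_def)
  have adm: "admissible n (P n, D n, c n)" for n
  proof (cases n)
    case (Suc k)
    then show ?thesis using step[of k] by (simp add: S refines_def)
  qed (use start S in simp)
  have int: "interpolant (P n) (D n)" and c_pos: "c n > 0"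
    and sep: "\<And>d x. d \<in> D n \<Longrightarrow> \<bar>x\<bar> \<le> real n \<Longrightarrow> 2 * c n * \<bar>x - d\<bar>
      \<le> norm (poly (P n) (complex_of_real x) - poly (P n) (complex_of_real d))" for n
    using adm[of n] by (auto simp: admissible_def)
  have ext: "extends (real n) (c n / 2) (P n) (D n) (P (Suc n)) (D (Suc n))"
    and c_half: "c (Suc n) \<le> c n / 2"
    and A_cov: "from_nat_into A n \<in> D (Suc n)"
    and B_cov: "from_nat_into B n \<in> (\<lambda>x. poly (P (Suc n)) (complex_of_real x)) ` D (Suc n)" for n
    using step[of n] by (auto simp: S refines_def)
  have D_Suc: "D n \<subseteq> D (Suc n)" for n using ext by (simp add: extends_def)
  have D_mono: "D m \<subseteq> D n" if "m \<le> n" for m n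
    using lift_Suc_mono_le[of D, OF D_Suc that] .
  have near: "near (real n) (c n / 2) (D n) (poly (P n)) (poly (P (Suc n)))" for n
    using ext by (simp add: extends_def)
  have hol: "poly (P n) holomorphic_on UNIV" for n
    using poly_holomorphic_on[OF holomorphic_on_ident] .
  obtain f where f: "f holomorphic_on UNIV"
    "\<And>z. (\<lambda>n. poly (P n) z) \<longlonglongrightarrow> f z"
    "\<And>n. near (real n) (c n) (D n) (poly (P n)) f"
    using hol c_pos c_half D_Suc near by (rule near_sequence_limit) (rule that)
  \<comment> \<open>Values at nodes are frozen, so the sequence is constant from stage
    \<open>n\<close> on.\<close>
  have fD: "f (complex_of_real d) = poly (P n) (complex_of_real d)" if d: "d \<in> D n" for n d
  proof -
    have "poly (P (n + j)) (complex_of_real d) = poly (P n) (complex_of_real d)" for j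
    proof (induction j)
      case (Suc j)
      have "d \<in> D (n + j)" using d D_mono[of n "n + j"] by auto
      then show ?case using Suc ext[of "n + j"] by (simp add: extends_def)
    qed simp
    then have "(\<lambda>j. poly (P (j + n)) (complex_of_real d)) \<longlonglongrightarrow> poly (P n) (complex_of_real d)"
      by (simp add: add.commute)
    then show ?thesis
      by (rule LIMSEQ_unique[OF LIMSEQ_ignore_initial_segment[OF f(2)]])
  qed
  \<comment> \<open>Of the separation \<open>2 * c n\<close> of \<open>P n\<close>, the passage from
    \<open>P n\<close> to \<open>f\<close> consumes at most one half, since its error is itself
    proportional to \<open>|x - d|\<close>.\<close>
  have f_sep: "c n * \<bar>x - d\<bar> \<le> norm (f (complex_of_real x) - f (complex_of_real d))"
    if d: "d \<in> D n" and x: "\<bar>x\<bar> \<le> real n" for n d x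
  proof -
    have "norm (f (complex_of_real x) - poly (P n) (complex_of_real x)) \<le> c n * \<bar>x - d\<bar>"
    proof -
      have "norm (f (complex_of_real x) - poly (P n) (complex_of_real x))
          \<le> c n * norm (complex_of_real x - complex_of_real d)"
        using f(3)[of n] d x by (simp add: near_def)
      then show ?thesis by (simp only: norm_of_real of_real_diff[symmetric])
    qed
    moreover have "norm (poly (P n) (complex_of_real x) - poly (P n) (complex_of_real d))
      \<le> norm (poly (P n) (complex_of_real x) - f (complex_of_real x))
        + norm (f (complex_of_real x) - poly (P n) (complex_of_real d))"
      using norm_triangle_ineq[of "poly (P n) (complex_of_real x) - f (complex_of_real x)"
          "f (complex_of_real x) - poly (P n) (complex_of_real d)"] by simp
    ultimately show ?thesis
      using sep[OF d x] fD[OF d] by (simp add: norm_minus_commute)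
  qed
  have D_A: "D n \<subseteq> A" for n using int by (simp add: interpolant_def)
  have A_D: "\<exists>n. a \<in> D n" if "a \<in> A" for a
    using A_cov from_nat_into_surj[OF countable_A that] by blast
  have f_A: "f (complex_of_real a) \<in> B" if "a \<in> A" for a
  proof -
    obtain n where n: "a \<in> D n" using A_D \<open>a \<in> A\<close> by blast
    then have "poly (P n) (complex_of_real a) \<in> B" using int[of n] by (simp add: interpolant_def)
    then show ?thesis by (simp only: fD[OF n])
  qed
  have B_f: "\<exists>a\<in>A. b = f (complex_of_real a)" if "b \<in> B" for b
  proof -
    obtain n where "b = from_nat_into B n"
      using from_nat_into_surj[OF countable_B \<open>b \<in> B\<close>] by metis
    then obtain d where "d \<in> D (Suc n)" "b = poly (P (Suc n)) (complex_of_real d)"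
      using B_cov[of n] by blast
    then show ?thesis using fD D_A by (metis subsetD)
  qed
  \<comment> \<open>Here \<open>x\<close> is any real number. Besides injectivity on
    \<open>A\<close>, this shows that no real point outside \<open>A\<close> is sent into
    \<open>B\<close>, as every element of \<open>B\<close> is a value on \<open>A\<close>.\<close>
  have f_inj: "x = a" if "a \<in> A" "f (complex_of_real x) = f (complex_of_real a)" for x a
  proof -
    obtain n where n: "a \<in> D n" using A_D \<open>a \<in> A\<close> by blast
    obtain k where k: "\<bar>x\<bar> \<le> real k" using real_arch_simple by blast
    have "c (max n k) * \<bar>x - a\<bar> \<le> norm (f (complex_of_real x) - f (complex_of_real a))"
      using n k D_mono[of n "max n k"] by (intro f_sep) auto
    then have "c (max n k) * \<bar>x - a\<bar> \<le> 0" using that by simp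
    then show ?thesis using c_pos[of "max n k"] by (simp add: mult_le_0_iff)
  qed
  have f_deriv: "deriv f (complex_of_real a) \<noteq> 0" if "a \<in> A" for a
  proof -
    obtain n where n: "a \<in> D n" using A_D \<open>a \<in> A\<close> by blast
    \<comment> \<open>The summand \<open>1\<close> keeps \<open>a + h\<close> inside the interval
      for all \<open>|h| < 1\<close>.\<close>
    obtain k where k: "\<bar>a\<bar> + 1 \<le> real k" using real_arch_simple by blast
    let ?m = "max n k"
    have "(f has_field_derivative deriv f (complex_of_real a)) (at (complex_of_real a))"
      using f(1) by (meson UNIV_I holomorphic_derivI open_UNIV)
    then have "((\<lambda>h. (f (complex_of_real a + h) - f (complex_of_real a)) / h)
        \<longlongrightarrow> deriv f (complex_of_real a)) (at 0)"
      by (simp add: DERIV_def)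
    \<comment> \<open>The complex derivative exists, so it may be computed along real increments,
      where \<open>f_sep\<close> bounds the difference quotient away from zero.\<close>
    moreover have "filterlim complex_of_real (at 0) (at (0::real))"
      unfolding filterlim_at by (auto intro!: tendsto_eq_intros simp: eventually_at_filter)
    ultimately have "((\<lambda>h. (f (complex_of_real a + complex_of_real h) - f (complex_of_real a))
        / complex_of_real h) \<longlongrightarrow> deriv f (complex_of_real a)) (at (0::real))"
      by (rule filterlim_compose)
    then have "((\<lambda>h. norm ((f (complex_of_real a + complex_of_real h) - f (complex_of_real a))
        / complex_of_real h)) \<longlongrightarrow> norm (deriv f (complex_of_real a))) (at (0::real))"
      by (rule tendsto_norm)
    moreover have "\<forall>\<^sub>F h in at (0::real). c ?m \<le>
        norm ((f (complex_of_real a + complex_of_real h) - f (complex_of_real a)) / complex_of_real h)"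
      unfolding eventually_at
    proof (intro exI[of _ 1] conjI ballI impI)
      fix h :: real assume h: "h \<noteq> 0 \<and> dist h 0 < 1"
      have "c ?m * \<bar>(a + h) - a\<bar> \<le> norm (f (complex_of_real (a + h)) - f (complex_of_real a))"
        using n k h D_mono[of n ?m] by (intro f_sep) auto
      then show "c ?m \<le>
        norm ((f (complex_of_real a + complex_of_real h) - f (complex_of_real a)) / complex_of_real h)"
        using h by (simp add: norm_divide field_simps)
    qed simp
    ultimately have "c ?m \<le> norm (deriv f (complex_of_real a))"
      by (rule tendsto_lowerbound) simp
    then show ?thesis using c_pos[of ?m] by auto
  qed
  have "f \<in> exact_curves"
    unfolding exact_curves_def mem_Collect_eq
  proof (intro conjI ballI)
    have "B \<subseteq> f ` \<real>" using B_f by (metis Reals_of_real imageI subsetI)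
    then show "transcendental_entire f"
      unfolding transcendental_entire_def
      using f(1) poly_image_reals_not_dense[OF dense_B] by blast
    show "bij_betw (\<lambda>a. f (complex_of_real a)) A B"
      unfolding bij_betw_def
    proof
      show "inj_on (\<lambda>a. f (complex_of_real a)) A"
        using f_inj by (auto intro: inj_onI)
      show "(\<lambda>a. f (complex_of_real a)) ` A = B"
        using f_A B_f by blast
    qed
    show "f -` B \<inter> \<real> = complex_of_real ` A"
    proof
      show "f -` B \<inter> \<real> \<subseteq> complex_of_real ` A"
      proof
        fix z assume "z \<in> f -` B \<inter> \<real>"
        then obtain x where x: "z = complex_of_real x" "f (complex_of_real x) \<in> B"
          by (auto simp: Reals_def)
        then obtain a where "a \<in> A" "f (complex_of_real x) = f (complex_of_real a)"
          using B_f by blast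
        then show "z \<in> complex_of_real ` A" using f_inj x by blast
      qed
    qed (use f_A in auto)
  qed (rule f_deriv)
  then show ?thesis using that fD by (simp add: P_def D_def)
qed

text \<open>Each step of the construction allows two incompatible choices, so the branches of a binary
  tree lead to different limits.\<close>

lemma nat_sets_lepoll_exact_curves: "(UNIV :: nat set set) \<lesssim> exact_curves"
proof -
  obtain p0 where p0: "admissible 0 (p0, {}, 1)" using admissible_start by blast
  obtain l r where lr: "\<And>n S. admissible n S \<Longrightarrow> refines n S (l n S) \<and> refines n S (r n S) \<and>
      (\<exists>x \<in> fst (snd (l n S)) \<inter> fst (snd (r n S)).
         poly (fst (l n S)) (complex_of_real x) \<noteq> poly (fst (r n S)) (complex_of_real x))"
    using refines_two_ways by metis
  \<comment> \<open>A set \<open>s\<close> of natural numbers encodes a branch: membership of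
    \<open>n\<close> selects the successor \<open>l\<close> at stage \<open>n\<close>.\<close>
  define run where "run = (\<lambda>s. rec_nat (p0, {}, 1) (\<lambda>n S. if n \<in> s then l n S else r n S))"
  have run_0: "run s 0 = (p0, {}, 1)"
    and run_Suc: "run s (Suc n) = (if n \<in> s then l n (run s n) else r n (run s n))" for s n
    by (simp_all add: run_def)
  have adm: "admissible n (run s n)" for s n
  proof (induction n)
    case (Suc n)
    then have "refines n (run s n) (run s (Suc n))" using lr by (simp add: run_Suc)
    then show ?case by (auto simp: refines_def)
  qed (simp add: run_0 p0)
  have ref: "refines n (run s n) (run s (Suc n))" for s n
    using lr adm by (simp add: run_Suc)
  have "\<exists>f. f \<in> exact_curves \<and> (\<forall>n. \<forall>d\<in>fst (snd (run s n)).
      f (complex_of_real d) = poly (fst (run s n)) (complex_of_real d))" for s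
    using limit_in_exact_curves[of "run s"] adm[where n = 0] ref by metis
  then obtain F where F: "\<And>s. F s \<in> exact_curves"
    "\<And>s n d. d \<in> fst (snd (run s n)) \<Longrightarrow>
      F s (complex_of_real d) = poly (fst (run s n)) (complex_of_real d)"
    by metis
  \<comment> \<open>Both runs coincide up to stage \<open>n\<close> and then split at a common node,
    whose two values are kept by the limits.\<close>
  have neq: "F s \<noteq> F t" if nst: "n \<in> s" "n \<notin> t" and agree: "\<And>m. m < n \<Longrightarrow> m \<in> s \<longleftrightarrow> m \<in> t" for s t n
  proof -
    have "run s m = run t m" if "m \<le> n" for m
      using that
    proof (induction m)
      case (Suc m)
      then show ?case using agree[of m] by (simp add: run_Suc)
    qed (simp add: run_0)
    then have "run s (Suc n) = l n (run s n)" "run t (Suc n) = r n (run s n)"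
      using nst by (auto simp: run_Suc)
    then show ?thesis
      using lr[OF adm[of n s]] F(2)[of _ s "Suc n"] F(2)[of _ t "Suc n"] by (metis IntE)
  qed
  have "inj F"
  proof (rule injI, rule ccontr)
    fix s t assume eq: "F s = F t" and "s \<noteq> t"
    then have "\<exists>n. (n \<in> s) \<noteq> (n \<in> t)" by blast
    then obtain n where "(n \<in> s) \<noteq> (n \<in> t)" "\<And>m. m < n \<Longrightarrow> m \<in> s \<longleftrightarrow> m \<in> t"
      using exists_least_iff[of "\<lambda>n. (n \<in> s) \<noteq> (n \<in> t)"] by metis
    then show False using neq[of n s t] neq[of n t s] eq by metis
  qed
  then show ?thesis
    using F(1) unfolding lepoll_def by blast
qed

end

section \<open>The upper bound and the cardinality\<close>

text \<open>By continuity the values on a countable dense set determine the function. Their real and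
  imaginary parts are encoded by rational cuts, and the index triples are countable, so the code
  becomes a set of natural numbers.\<close>

lemma entire_lepoll_nat_sets: "{f. f holomorphic_on (UNIV :: complex set)} \<lesssim> (UNIV :: nat set set)"
proof -
  obtain C :: "complex set" where C: "countable C"
    "\<And>X. open X \<Longrightarrow> X \<noteq> {} \<Longrightarrow> \<exists>d\<in>C. d \<in> X"
    using countable_dense_setE by blast
  have "C \<noteq> {}" using C(2)[OF open_UNIV] by blast
  \<comment> \<open>The Boolean selects the real or the imaginary part.\<close>
  define cut :: "(complex \<Rightarrow> complex) \<Rightarrow> (nat \<times> rat \<times> bool) set" where
    "cut = (\<lambda>f. {(n, q, b). (if b then Re else Im) (f (from_nat_into C n)) < of_rat q})"
  have rat_cut: "x = y" if "\<And>q. x < of_rat q \<longleftrightarrow> y < of_rat q" for x y :: real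
  proof (rule linorder_cases[of x y])
    assume "x < y"
    then show ?thesis using that of_rat_dense[of x y] by (meson less_asym)
  next
    assume "y < x"
    then show ?thesis using that of_rat_dense[of y x] by (meson less_asym)
  qed
  have "inj_on cut {f. f holomorphic_on UNIV}"
  proof (rule inj_onI)
    fix f g assume fg: "f \<in> {f. f holomorphic_on UNIV}" "g \<in> {f. f holomorphic_on UNIV}"
      and eq: "cut f = cut g"
    have cut_iff: "(if b then Re else Im) (f (from_nat_into C n)) < of_rat q \<longleftrightarrow>
        (if b then Re else Im) (g (from_nat_into C n)) < of_rat q" for n q b
      using arg_cong[OF eq, of "\<lambda>X. (n, q, b) \<in> X"] by (simp add: cut_def)
    have "f (from_nat_into C n) = g (from_nat_into C n)" for n
      using cut_iff[of True n] cut_iff[of False n] by (intro complex_eqI rat_cut) auto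
    then have on_C: "f z = g z" if "z \<in> C" for z
      using from_nat_into_surj[OF C(1) that] by metis
    have cont: "continuous_on UNIV (\<lambda>z. f z - g z)"
      using fg by (intro holomorphic_on_imp_continuous_on holomorphic_on_diff) auto
    then have "open {z. f z - g z \<noteq> 0}"
      by (intro open_Collect_neq) auto
    then have "{z. f z - g z \<noteq> 0} = {}"
      using C(2)[of "{z. f z - g z \<noteq> 0}"] on_C by force
    then show "f = g" by auto
  qed
  then have "inj_on (\<lambda>f. to_nat ` cut f) {f. f holomorphic_on UNIV}"
    by (auto simp: inj_on_def inj_image_eq_iff)
  then show ?thesis unfolding lepoll_def by blast
qed

theorem corollary2p6:
  fixes A :: "real set" and B :: "complex set"
  assumes "countable A" and "closure A = UNIV"
    and "countable B" and "closure B = UNIV"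
  shows "{f. transcendental_entire f
           \<and> bij_betw (\<lambda>a. f (complex_of_real a)) A B
           \<and> f -` B \<inter> \<real> = complex_of_real ` A
           \<and> (\<forall>a\<in>A. deriv f (complex_of_real a) \<noteq> 0)}
         \<approx> (UNIV :: real set)"
proof -
  interpret countable_dense_pair A B
    using assms by unfold_locales
  have "exact_curves \<lesssim> {f. f holomorphic_on (UNIV :: complex set)}"
    by (rule subset_imp_lepoll) (auto simp: exact_curves_def transcendental_entire_def)
  then have "exact_curves \<lesssim> (UNIV :: nat set set)"
    using entire_lepoll_nat_sets by (rule lepoll_trans)
  then have "exact_curves \<approx> (UNIV :: nat set set)"
    using nat_sets_lepoll_exact_curves by (rule lepoll_antisym)
  then have "exact_curves \<approx> (UNIV :: real set)"
    using nat_sets_eqpoll_reals by (rule eqpoll_trans)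
  then show ?thesis unfolding exact_curves_def .
qed

end
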